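(* Let $(X,f)$ be a topological dynamical system, and $\varphi,\psi\in C(X,\mathbb{R})$ with $0<m\le\psi(x)\le M$ for each $x\in X$. Then each of the following equals $P_\psi(\varphi)$: (i) $\displaystyle\lim_{\delta\to0}\sup_\alpha\limsup_{T\to\infty}\frac1T\log p_{\psi,T}(f,\varphi,\alpha)$, where the supremum is taken over all open covers $\alpha$ of $X$ with $\operatorname{diam}(\alpha)\le\delta$; (ii) $\displaystyle\lim_{k\to\infty}\limsup_{T\to\infty}\frac1T\log p_{\psi,T}(f,\varphi,\alpha_k)$, where $\{\alpha_k\}_{k\in\mathbb{N}}$ is a sequence of open covers of $X$ with $\operatorname{diam}(\alpha_k)\to0$ as $k\to\infty$; (iii) $\displaystyle\lim_{\delta\to0}\sup_\alpha\limsup_{T\to\infty}\frac1T\log q_{\psi,T}(f,\varphi,\alpha)$, where the supremum is taken over all open covers $\alpha$ of $X$ with $\operatorname{diam}(\alpha)\le\delta$; (iv) $\displaystyle\lim_{k\to\infty}\limsup_{T\to\infty}\frac1T\log q_{\psi,T}(f,\varphi,\alpha_k)$, where $\{\alpha_k\}_{k\in\mathbb{N}}$ is a sequence of open covers of $X$ with $\operatorname{diam}(\alpha_k)\to0$ as $k\to\infty$; (v) $\displaystyle\sup_\alpha\limsup_{T\to\infty}\frac1T\log q_{\psi,T}(f,\varphi,\alpha)$, where the supremum is taken over all open covers $\alpha$ of $X$.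
   Context: A topological dynamical system (TDS) $(X,f)$ is a continuous map $f:X\to X$ on a compact metric space $(X,d)$. $C(X,\mathbb{R})$ is the space of continuous real functions on $X$; $S_n\varphi=\sum_{i=0}^{n-1}\varphi\circ f^i$; $\mathbb{N}$ denotes the positive integers. Let $d_n(x,y)=\max\{d(f^ix,f^iy):0\le i\le n-1\}$. For nonempty $Z\subset X$, a set $F_n\subset X$ is an $(n,\varepsilon)$-spanning set of $Z$ if for each $y\in Z$ there is $x\in F_n$ with $d_n(x,y)\le\varepsilon$. For $\psi>0$ and $T>0$ let $S_T=\{n\in\mathbb{N}:\exists x\in X,\ S_n\psi(x)\le T\text{ and }S_{n+1}\psi(x)>T\}$, and for $n\in S_T$ let $X_n=\{x\in X:S_n\psi(x)\le T\text{ and }S_{n+1}\psi(x)>T\}$. Put $$Q_{\psi,T}(f,\varphi,\varepsilon)=\inf\Big\{\sum_{n\in S_T}\sum_{x\in F_n}e^{S_n\varphi(x)}:F_n\text{ is an }(n,\varepsilon)\text{-spanning set of }X_n,\ n\in S_T\Big\}.$$ The $\psi$-induced topological pressure of $\varphi$ is $P_\psi(\varphi)=\lim_{\varepsilon\to0}\limsup_{T\to\infty}\frac1T\log Q_{\psi,T}(f,\varphi,\varepsilon)$. For an open cover $\alpha$ of $X$, $\operatorname{diam}(\alpha)$ is the supremum of the diameters of its elements, and $\bigvee_{i=0}^{n-1}f^{-i}\alpha$ is the cover by the sets $\bigcap_{i=0}^{n-1}f^{-i}A_i$ with $A_i\in\alpha$. Put $$q_{\psi,T}(f,\varphi,\alpha)=\inf\Big\{\sum_{n\in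 S_T}\sum_{B\in\beta_n}\inf_{x\in B}e^{S_n\varphi(x)}:\beta_n\subset\bigvee_{i=0}^{n-1}f^{-i}\alpha,\ X_n\subset\bigcup_{B\in\beta_n}B,\ n\in S_T\Big\},$$ $$p_{\psi,T}(f,\varphi,\alpha)=\inf\Big\{\sum_{n\in S_T}\sum_{B\in\beta_n}\sup_{x\in B}e^{S_n\varphi(x)}:\beta_n\subset\bigvee_{i=0}^{n-1}f^{-i}\alpha,\ X_n\subset\bigcup_{B\in\beta_n}B,\ n\in S_T\Big\}.$$ *)

theory Defs
  imports "HOL-Analysis.Analysis"
begin

text \<open>
  A topological dynamical system is a map \<open>f :: 'a \<Rightarrow> 'a\<close> on a metric-space type with
  \<open>compact (UNIV :: 'a set)\<close> and \<open>continuous_on UNIV f\<close>; the space \<open>X\<close> is the whole type.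
\<close>

definition birkhoff_sum :: "('a \<Rightarrow> 'a) \<Rightarrow> ('a \<Rightarrow> real) \<Rightarrow> nat \<Rightarrow> 'a \<Rightarrow> real" where
  "birkhoff_sum f \<phi> n x = (\<Sum>i<n. \<phi> ((f ^^ i) x))"

text \<open>Only meaningful for \<open>n \<ge> 1\<close>, and only used there.\<close>

definition bowen_dist :: "('a::metric_space \<Rightarrow> 'a) \<Rightarrow> nat \<Rightarrow> 'a \<Rightarrow> 'a \<Rightarrow> real" where
  "bowen_dist f n x y = (MAX i\<in>{..<n}. dist ((f ^^ i) x) ((f ^^ i) y))"

definition spanning_set ::
  "('a::metric_space \<Rightarrow> 'a) \<Rightarrow> nat \<Rightarrow> real \<Rightarrow> 'a set \<Rightarrow> 'a set \<Rightarrow> bool" where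
  "spanning_set f n \<epsilon> Z F \<longleftrightarrow> (\<forall>y\<in>Z. \<exists>x\<in>F. bowen_dist f n x y \<le> \<epsilon>)"

definition level_set :: "('a \<Rightarrow> 'a) \<Rightarrow> ('a \<Rightarrow> real) \<Rightarrow> real \<Rightarrow> nat \<Rightarrow> 'a set" where
  "level_set f \<psi> T n = {x. birkhoff_sum f \<psi> n x \<le> T \<and> birkhoff_sum f \<psi> (Suc n) x > T}"

definition level_times :: "('a \<Rightarrow> 'a) \<Rightarrow> ('a \<Rightarrow> real) \<Rightarrow> real \<Rightarrow> nat set" where
  "level_times f \<psi> T =
     {n. 1 \<le> n \<and> (\<exists>x. birkhoff_sum f \<psi> n x \<le> T \<and> birkhoff_sum f \<psi> (Suc n) x > T)}"

text \<open>
  The sums are \<open>ennreal\<close>-valued \<open>infsum\<close>s, since spanning sets and subfamilies of covers are not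
  required to be finite; every such sum exists.
\<close>

definition Q_induced ::
  "('a::metric_space \<Rightarrow> 'a) \<Rightarrow> ('a \<Rightarrow> real) \<Rightarrow> ('a \<Rightarrow> real) \<Rightarrow> real \<Rightarrow> real \<Rightarrow> ennreal" where
  "Q_induced f \<psi> \<phi> T \<epsilon> =
     (INF F \<in> {F :: nat \<Rightarrow> 'a set.
                 \<forall>n\<in>level_times f \<psi> T. spanning_set f n \<epsilon> (level_set f \<psi> T n) (F n)}.
        \<Sum>\<^sub>\<infinity>n\<in>level_times f \<psi> T. \<Sum>\<^sub>\<infinity>x\<in>F n. ennreal (exp (birkhoff_sum f \<phi> n x)))"

definition open_cover :: "'a::topological_space set set \<Rightarrow> bool" where
  "open_cover \<alpha> \<longleftrightarrow> (\<forall>A\<in>\<alpha>. open A) \<and> \<Union>\<alpha> = UNIV"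

definition cover_diam :: "'a::metric_space set set \<Rightarrow> real" where
  "cover_diam \<alpha> = (SUP A\<in>\<alpha>. diameter A)"

definition cover_join :: "('a \<Rightarrow> 'a) \<Rightarrow> 'a set set \<Rightarrow> nat \<Rightarrow> 'a set set" where
  "cover_join f \<alpha> n = {(\<Inter>i<n. (f ^^ i) -` A i) | A :: nat \<Rightarrow> 'a set. \<forall>i<n. A i \<in> \<alpha>}"

definition cover_families ::
  "('a \<Rightarrow> 'a) \<Rightarrow> ('a \<Rightarrow> real) \<Rightarrow> real \<Rightarrow> 'a set set \<Rightarrow> (nat \<Rightarrow> 'a set set) set" where
  "cover_families f \<psi> T \<alpha> =
     {\<beta>. \<forall>n\<in>level_times f \<psi> T. \<beta> n \<subseteq> cover_join f \<alpha> n \<and> level_set f \<psi> T n \<subseteq> \<Union>(\<beta> n)}"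

text \<open>
  An empty member of a subfamily contributes \<open>\<infinity>\<close> to the sum in \<open>q_induced\<close> and \<open>0\<close> to the sum in
  \<open>p_induced\<close>; it can always be dropped, so it does not affect either infimum.
\<close>

definition q_induced ::
  "('a \<Rightarrow> 'a) \<Rightarrow> ('a \<Rightarrow> real) \<Rightarrow> ('a \<Rightarrow> real) \<Rightarrow> real \<Rightarrow> 'a set set \<Rightarrow> ennreal" where
  "q_induced f \<psi> \<phi> T \<alpha> =
     (INF \<beta> \<in> cover_families f \<psi> T \<alpha>.
        \<Sum>\<^sub>\<infinity>n\<in>level_times f \<psi> T. \<Sum>\<^sub>\<infinity>B\<in>\<beta> n. INF x\<in>B. ennreal (exp (birkhoff_sum f \<phi> n x)))"

definition p_induced ::
  "('a \<Rightarrow> 'a) \<Rightarrow> ('a \<Rightarrow> real) \<Rightarrow> ('a \<Rightarrow> real) \<Rightarrow> real \<Rightarrow> 'a set set \<Rightarrow> ennreal" where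
  "p_induced f \<psi> \<phi> T \<alpha> =
     (INF \<beta> \<in> cover_families f \<psi> T \<alpha>.
        \<Sum>\<^sub>\<infinity>n\<in>level_times f \<psi> T. \<Sum>\<^sub>\<infinity>B\<in>\<beta> n. SUP x\<in>B. ennreal (exp (birkhoff_sum f \<phi> n x)))"

definition log_ennreal :: "ennreal \<Rightarrow> ereal" where
  "log_ennreal z =
     (if z = 0 then -\<infinity> else if z = \<infinity> then \<infinity> else ereal (ln (enn2real z)))"

definition growth_rate :: "(real \<Rightarrow> ennreal) \<Rightarrow> ereal" where
  "growth_rate g = Limsup at_top (\<lambda>T::real. ereal (1 / T) * log_ennreal (g T))"

text \<open>The pressure may be \<open>\<infinity>\<close>, so it takes values in \<open>ereal\<close>.\<close>

definition induced_pressure ::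
  "('a::metric_space \<Rightarrow> 'a) \<Rightarrow> ('a \<Rightarrow> real) \<Rightarrow> ('a \<Rightarrow> real) \<Rightarrow> ereal" where
  "induced_pressure f \<psi> \<phi> =
     Lim (at_right 0) (\<lambda>\<epsilon>::real. growth_rate (\<lambda>T. Q_induced f \<psi> \<phi> T \<epsilon>))"

lemma log_ennreal_mono:
  assumes "a \<le> b"
  shows "log_ennreal a \<le> log_ennreal b"
proof (cases "a = 0 \<or> b = \<infinity>")
  case True
  then show ?thesis
    using assms by (auto simp: log_ennreal_def)
next
  case False
  then have "b \<noteq> 0" "a \<noteq> \<infinity>" "a \<noteq> 0" "b \<noteq> \<infinity>"
    using assms by (auto simp: top_unique)
  moreover have "0 < enn2real a" "enn2real a \<le> enn2real b"
    using calculation assms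
    by (auto simp: enn2real_positive_iff less_top zero_less_iff_neq_zero intro!: enn2real_mono)
  ultimately show ?thesis
    by (auto simp: log_ennreal_def)
qed

lemma growth_rate_mono:
  assumes "\<And>T. g T \<le> h T"
  shows "growth_rate g \<le> growth_rate h"
  unfolding growth_rate_def
proof (rule Limsup_mono)
  show "\<forall>\<^sub>F T::real in at_top.
          ereal (1 / T) * log_ennreal (g T) \<le> ereal (1 / T) * log_ennreal (h T)"
    using eventually_gt_at_top[of 0]
    by eventually_elim (intro ereal_mult_left_mono log_ennreal_mono assms, auto)
qed

lemma Q_induced_antimono:
  assumes "\<epsilon> \<le> \<epsilon>'"
  shows "Q_induced f \<psi> \<phi> T \<epsilon>' \<le> Q_induced f \<psi> \<phi> T \<epsilon>"
  unfolding Q_induced_def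
proof (rule INF_superset_mono)
  have "spanning_set f n \<epsilon>' Z F" if "spanning_set f n \<epsilon> Z F" for n Z F
    using that assms unfolding spanning_set_def by (meson order_trans)
  then show "{F. \<forall>n\<in>level_times f \<psi> T. spanning_set f n \<epsilon> (level_set f \<psi> T n) (F n)}
      \<subseteq> {F. \<forall>n\<in>level_times f \<psi> T. spanning_set f n \<epsilon>' (level_set f \<psi> T n) (F n)}"
    by blast
qed simp

text \<open>The limit in the definition of the pressure exists, by monotonicity in \<open>\<epsilon>\<close>.\<close>

lemma induced_pressure_tendsto:
  "((\<lambda>\<epsilon>. growth_rate (\<lambda>T. Q_induced f \<psi> \<phi> T \<epsilon>)) \<longlongrightarrow> induced_pressure f \<psi> \<phi>) (at_right 0)"
proof -
  define g where "g = (\<lambda>\<epsilon>. growth_rate (\<lambda>T. Q_induced f \<psi> \<phi> T \<epsilon>))"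
  have anti: "g b \<le> g a" if "a \<le> b" for a b
    unfolding g_def by (intro growth_rate_mono Q_induced_antimono that)
  have "(g \<longlongrightarrow> (SUP \<epsilon>\<in>{0<..}. g \<epsilon>)) (at_right 0)"
  proof (rule increasing_tendsto)
    show "\<forall>\<^sub>F \<epsilon> in at_right 0. g \<epsilon> \<le> (SUP \<epsilon>\<in>{0<..}. g \<epsilon>)"
      using eventually_at_right_less[of 0] by eventually_elim (auto intro: SUP_upper)
  next
    fix y assume "y < (SUP \<epsilon>\<in>{0<..}. g \<epsilon>)"
    then obtain e where e: "0 < e" "y < g e"
      by (auto simp: less_SUP_iff)
    have "\<forall>\<^sub>F \<epsilon> in at_right 0. \<epsilon> < e"
      using e(1) by (auto simp: eventually_at_right_field)
    then show "\<forall>\<^sub>F \<epsilon> in at_right 0. y < g \<epsilon>"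
      by eventually_elim (use e anti in \<open>auto intro: less_le_trans\<close>)
  qed
  then show ?thesis
    unfolding induced_pressure_def g_def by (simp add: tendsto_Lim)
qed

end

theory Submission
  imports Defs
begin

text \<open>
  Write \<open>Q \<epsilon>\<close>, \<open>p \<alpha>\<close>, \<open>q \<alpha>\<close> for the exponential growth rates in \<open>T\<close> of the three partition
  functions. The theorem follows from three comparisons and a squeeze.

  First, \<open>q \<alpha> \<le> Q \<epsilon>\<close> for every open cover \<open>\<alpha>\<close>, once \<open>\<epsilon>\<close> is below a Lebesgue number of \<open>\<alpha>\<close>
  (\<open>q_induced_le_Q_induced\<close>): a Bowen ball of radius \<open>\<epsilon>\<close> is then contained in a member of the
  \<open>n\<close>-th join of \<open>\<alpha>\<close> that contains its centre. Secondly, \<open>Q \<epsilon> \<le> p \<alpha>\<close> whenever \<open>\<alpha>\<close> has diameter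
  at most \<open>\<epsilon>\<close> (\<open>Q_induced_le_p_induced\<close>), because one point from each member of a subfamily of the
  join gives a spanning set. Thirdly, on a member of the \<open>n\<close>-th join of a cover of small diameter
  the sums \<open>S\<^sub>n\<phi>\<close> oscillate by at most \<open>n \<eta> m\<close>, by uniform continuity of \<open>\<phi>\<close>; since \<open>\<psi> \<ge> m > 0\<close>,
  only times \<open>n \<le> T / m\<close> occur at level \<open>T\<close>, so the oscillation is at most \<open>\<eta> T\<close> and
  \<open>p \<alpha> \<le> q \<alpha> + \<eta>\<close> (\<open>growth_rate_p_le_q\<close>).

  As \<open>Q \<epsilon>\<close> increases to the pressure \<open>P\<close> when \<open>\<epsilon>\<close> decreases to \<open>0\<close>, all covers \<open>\<alpha>\<close> of diameter at
  most a small \<open>\<delta>\<close> satisfy \<open>Q \<delta> \<le> p \<alpha> \<le> q \<alpha> + \<eta> \<le> P + \<eta>\<close>. This uniform estimate gives the limits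
  of the suprema as well as the limits along sequences of covers, and the bound \<open>q \<alpha> \<le> P\<close>, which
  needs no smallness of \<open>\<alpha>\<close>, gives the last formula.
\<close>

section \<open>Sums of extended nonnegative reals\<close>

lemma summable_on_ennreal_valued [simp, intro!]:
  fixes g :: "'b \<Rightarrow> ennreal"
  shows "g summable_on A"
  by (rule nonneg_summable_on_complete) simp

lemma infsum_cmult_right_ennreal:
  fixes g :: "'b \<Rightarrow> ennreal" and c :: ennreal
  assumes "c < top"
  shows "(\<Sum>\<^sub>\<infinity>x\<in>A. c * g x) = c * (\<Sum>\<^sub>\<infinity>x\<in>A. g x)"
proof -
  have "infsum ((*) c \<circ> g) A = c * infsum g A"
  proof (rule infsum_comm_additive_general)
    show "isCont ((*) c) (infsum g A)"
      unfolding isCont_def using assms by (intro ennreal_tendsto_cmult tendsto_ident_at)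
  qed (auto simp: sum_distrib_left)
  then show ?thesis by (simp add: o_def)
qed

text \<open>The map \<open>h\<close> need not be injective: each point of the image is charged to one preimage.\<close>

lemma infsum_image_le_ennreal:
  fixes u :: "'c \<Rightarrow> ennreal" and v :: "'b \<Rightarrow> ennreal"
  assumes "\<And>a. a \<in> A \<Longrightarrow> u (h a) \<le> v a"
  shows "infsum u (h ` A) \<le> infsum v A"
proof -
  let ?i = "inv_into A h"
  have "infsum u (h ` A) \<le> infsum (v \<circ> ?i) (h ` A)"
  proof (rule infsum_mono)
    fix b assume "b \<in> h ` A"
    then show "u b \<le> (v \<circ> ?i) b"
      using assms[of "?i b"] by (simp add: inv_into_into f_inv_into_f)
  qed auto
  also have "\<dots> = infsum v (?i ` h ` A)"
    by (rule infsum_reindex[symmetric]) (rule inj_on_inv_into, simp)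
  also have "\<dots> \<le> infsum v A"
    by (rule infsum_mono_neutral) (auto simp: inv_into_into)
  finally show ?thesis .
qed

text \<open>
  Moving the factor to the left reduces a comparison with a multiple of an infimum to its members.
\<close>

lemma le_exp_mult_iff:
  "x \<le> ennreal (exp t) * y \<longleftrightarrow> ennreal (exp (- t)) * x \<le> y"
proof -
  have inv: "ennreal (exp (- t)) * ennreal (exp t) = 1"
    by (simp add: ennreal_mult[symmetric] exp_add[symmetric])
  show ?thesis
  proof
    assume "x \<le> ennreal (exp t) * y"
    then have "ennreal (exp (- t)) * x \<le> ennreal (exp (- t)) * (ennreal (exp t) * y)"
      by (rule mult_left_mono) simp
    also have "\<dots> = y"
      by (simp only: mult.assoc[symmetric] inv mult_1_left)
    finally show "ennreal (exp (- t)) * x \<le> y" .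
  next
    assume "ennreal (exp (- t)) * x \<le> y"
    then have "ennreal (exp t) * (ennreal (exp (- t)) * x) \<le> ennreal (exp t) * y"
      by (rule mult_left_mono) simp
    moreover have "ennreal (exp t) * (ennreal (exp (- t)) * x) = x"
      by (simp only: mult.assoc[symmetric] mult.commute[of "ennreal (exp t)"] inv mult_1_left)
    ultimately show "x \<le> ennreal (exp t) * y" by simp
  qed
qed

section \<open>Growth rates\<close>

lemma log_ennreal_exp_mult:
  "log_ennreal (ennreal (exp c) * z) = ereal c + log_ennreal z"
proof (cases z)
  case (real r)
  then show ?thesis
    by (cases "r = 0")
       (auto simp: log_ennreal_def ennreal_mult[symmetric] ln_mult ennreal_eq_0_iff mult_le_0_iff)
next
  case top
  then show ?thesis
    by (simp add: log_ennreal_def ennreal_mult_top)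
qed

lemma growth_rate_exp_le:
  assumes "\<And>T. g T \<le> ennreal (exp (\<eta> * T)) * h T"
  shows "growth_rate g \<le> growth_rate h + ereal \<eta>"
proof -
  have "growth_rate g \<le> Limsup at_top (\<lambda>T. ereal (1 / T) * log_ennreal (h T) + ereal \<eta>)"
    unfolding growth_rate_def
  proof (rule Limsup_mono)
    show "\<forall>\<^sub>F T::real in at_top. ereal (1 / T) * log_ennreal (g T)
            \<le> ereal (1 / T) * log_ennreal (h T) + ereal \<eta>"
      using eventually_gt_at_top[of 0]
    proof eventually_elim
      fix T :: real assume T: "0 < T"
      have "log_ennreal (g T) \<le> ereal (\<eta> * T) + log_ennreal (h T)"
        using log_ennreal_mono[OF assms[of T]] by (simp add: log_ennreal_exp_mult)
      then have "ereal (1 / T) * log_ennreal (g T)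
          \<le> ereal (1 / T) * (ereal (\<eta> * T) + log_ennreal (h T))"
        by (rule ereal_mult_left_mono) (use T in auto)
      also have "\<dots> = ereal (1 / T) * log_ennreal (h T) + ereal \<eta>"
        using T by (cases "log_ennreal (h T)") (auto simp: field_simps)
      finally show "ereal (1 / T) * log_ennreal (g T)
          \<le> ereal (1 / T) * log_ennreal (h T) + ereal \<eta>" .
    qed
  qed
  also have "\<dots> = growth_rate h + ereal \<eta>"
    unfolding growth_rate_def by (rule Limsup_add_ereal_right) auto
  finally show ?thesis .
qed

section \<open>Open covers of small diameter\<close>

text \<open>
  Compactness of the space bounds all diameters, so that the real suprema in \<open>diameter\<close> and
  \<open>cover_diam\<close> are genuine upper bounds.
\<close>

lemma dist_le_cover_diam:
  fixes \<alpha> :: "'a::metric_space set set"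
  assumes "compact (UNIV :: 'a set)" "A \<in> \<alpha>" "x \<in> A" "y \<in> A"
  shows "dist x y \<le> cover_diam \<alpha>"
proof -
  have bounded: "bounded S" for S :: "'a set"
    using assms(1) bounded_subset compact_imp_bounded by blast
  have "dist x y \<le> diameter A"
    using diameter_bounded_bound[OF bounded assms(3,4)] .
  also have "\<dots> \<le> cover_diam \<alpha>"
    unfolding cover_diam_def
  proof (rule cSUP_upper[OF assms(2)])
    show "bdd_above (diameter ` \<alpha>)"
      by (rule bdd_aboveI[of _ "diameter (UNIV :: 'a set)"])
         (auto intro: diameter_subset bounded)
  qed
  finally show ?thesis .
qed

lemma ex_open_cover_diam_le:
  assumes "0 < \<delta>"
  shows "\<exists>\<alpha> :: 'a::metric_space set set. open_cover \<alpha> \<and> cover_diam \<alpha> \<le> \<delta>"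
proof (intro exI conjI)
  let ?\<alpha> = "range (\<lambda>x::'a. ball x (\<delta> / 2))"
  show "open_cover ?\<alpha>"
    unfolding open_cover_def using assms by fastforce
  have "diameter (ball x (\<delta> / 2)) \<le> \<delta>" for x :: 'a
  proof -
    have "dist y z \<le> \<delta>" if "y \<in> ball x (\<delta> / 2)" "z \<in> ball x (\<delta> / 2)" for y z
      using that dist_triangle2[of y z x] by (simp add: dist_commute)
    then show ?thesis
      using assms unfolding diameter_def by (auto intro!: cSUP_least)
  qed
  then show "cover_diam ?\<alpha> \<le> \<delta>"
    unfolding cover_diam_def by (intro cSUP_least) auto
qed

lemma dist_le_of_mem_cover_join:
  fixes f :: "'a::metric_space \<Rightarrow> 'a"
  assumes "compact (UNIV :: 'a set)" "cover_diam \<alpha> \<le> \<epsilon>"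
    and "B \<in> cover_join f \<alpha> n" "x \<in> B" "y \<in> B" "i < n"
  shows "dist ((f ^^ i) x) ((f ^^ i) y) \<le> \<epsilon>"
proof -
  obtain A where "B = (\<Inter>i<n. (f ^^ i) -` A i)" "\<forall>i<n. A i \<in> \<alpha>"
    using assms(3) unfolding cover_join_def by blast
  then have "dist ((f ^^ i) x) ((f ^^ i) y) \<le> cover_diam \<alpha>"
    using assms by (intro dist_le_cover_diam[of "A i"]) auto
  then show ?thesis using assms(2) by simp
qed

lemma bowen_dist_le_iff:
  assumes "1 \<le> n"
  shows "bowen_dist f n x y \<le> \<epsilon> \<longleftrightarrow> (\<forall>i<n. dist ((f ^^ i) x) ((f ^^ i) y) \<le> \<epsilon>)"
  unfolding bowen_dist_def using assms by (subst Max_le_iff) (auto simp: lessThan_empty_iff)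

section \<open>Comparison of the partition functions\<close>

lemma ex_Lebesgue_radius:
  fixes \<alpha> :: "'a::metric_space set set"
  assumes "compact (UNIV :: 'a set)" "open_cover \<alpha>"
  obtains \<epsilon> where "0 < \<epsilon>" "\<And>x. \<exists>A\<in>\<alpha>. cball x \<epsilon> \<subseteq> A"
proof -
  obtain e where e: "0 < e" "\<forall>x\<in>UNIV. \<exists>A\<in>\<alpha>. ball x e \<subseteq> A"
    using Heine_Borel_lemma[OF assms(1), of \<alpha>] assms(2) unfolding open_cover_def by auto
  have "\<exists>A\<in>\<alpha>. cball x (e / 2) \<subseteq> A" for x
  proof -
    have "cball x (e / 2) \<subseteq> ball x e" using e(1) by auto
    moreover obtain A where "A \<in> \<alpha>" "ball x e \<subseteq> A" using e(2) by auto
    ultimately show ?thesis by (meson order_trans)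
  qed
  then show ?thesis using that[of "e / 2"] e(1) by simp
qed

text \<open>
  A point \<open>x\<close> of a spanning set is sent to the member of the join built from elements of \<open>\<alpha>\<close> that
  contain the closed \<open>\<epsilon>\<close>-balls around the points of its orbit. Several points may have the same image.
\<close>

lemma q_induced_le_Q_induced:
  fixes f :: "'a::metric_space \<Rightarrow> 'a"
  assumes Lebesgue: "\<And>x. \<exists>A\<in>\<alpha>. cball x \<epsilon> \<subseteq> A" and "0 < \<epsilon>"
  shows "q_induced f \<psi> \<phi> T \<alpha> \<le> Q_induced f \<psi> \<phi> T \<epsilon>"
  unfolding Q_induced_def
proof (rule INF_greatest)
  fix F assume "F \<in> {F. \<forall>n\<in>level_times f \<psi> T. spanning_set f n \<epsilon> (level_set f \<psi> T n) (F n)}"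
  then have F: "spanning_set f n \<epsilon> (level_set f \<psi> T n) (F n)" if "n \<in> level_times f \<psi> T" for n
    using that by blast
  from Lebesgue obtain A where A: "\<And>x. A x \<in> \<alpha>" "\<And>x. cball x \<epsilon> \<subseteq> A x" by metis
  define B where "B n x = (\<Inter>i<n. (f ^^ i) -` A ((f ^^ i) x))" for n x
  have mem: "x \<in> B n x" for n x
    using A(2) \<open>0 < \<epsilon>\<close> unfolding B_def by fastforce
  have "(\<lambda>n. B n ` F n) \<in> cover_families f \<psi> T \<alpha>"
    unfolding cover_families_def mem_Collect_eq
  proof (intro ballI conjI subsetI)
    fix n X assume "X \<in> B n ` F n"
    then obtain x where "X = (\<Inter>i<n. (f ^^ i) -` A ((f ^^ i) x))"
      unfolding B_def by auto
    then show "X \<in> cover_join f \<alpha> n"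
      unfolding cover_join_def mem_Collect_eq
      by (intro exI[of _ "\<lambda>i. A ((f ^^ i) x)"]) (simp add: A(1))
  next
    fix n y assume n: "n \<in> level_times f \<psi> T" and "y \<in> level_set f \<psi> T n"
    then obtain x where x: "x \<in> F n" "bowen_dist f n x y \<le> \<epsilon>"
      using F unfolding spanning_set_def by blast
    have "1 \<le> n" using n by (simp add: level_times_def)
    then have "y \<in> B n x"
      using x(2) A(2) unfolding B_def by (auto simp: bowen_dist_le_iff subset_iff)
    then show "y \<in> \<Union>(B n ` F n)" using x(1) by blast
  qed
  then have "q_induced f \<psi> \<phi> T \<alpha> \<le> (\<Sum>\<^sub>\<infinity>n\<in>level_times f \<psi> T. \<Sum>\<^sub>\<infinity>X\<in>B n ` F n.
      INF x\<in>X. ennreal (exp (birkhoff_sum f \<phi> n x)))"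
    unfolding q_induced_def by (rule INF_lower)
  also have "\<dots> \<le> (\<Sum>\<^sub>\<infinity>n\<in>level_times f \<psi> T. \<Sum>\<^sub>\<infinity>x\<in>F n. ennreal (exp (birkhoff_sum f \<phi> n x)))"
    by (intro infsum_mono infsum_image_le_ennreal INF_lower mem) auto
  finally show "q_induced f \<psi> \<phi> T \<alpha>
      \<le> (\<Sum>\<^sub>\<infinity>n\<in>level_times f \<psi> T. \<Sum>\<^sub>\<infinity>x\<in>F n. ennreal (exp (birkhoff_sum f \<phi> n x)))" .
qed

lemma Q_induced_le_p_induced:
  fixes f :: "'a::metric_space \<Rightarrow> 'a"
  assumes "compact (UNIV :: 'a set)" "cover_diam \<alpha> \<le> \<epsilon>"
  shows "Q_induced f \<psi> \<phi> T \<epsilon> \<le> p_induced f \<psi> \<phi> T \<alpha>"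
  unfolding p_induced_def
proof (rule INF_greatest)
  fix \<beta> assume \<beta>: "\<beta> \<in> cover_families f \<psi> T \<alpha>"
  \<comment> \<open>The empty set may occur in \<open>\<beta> n\<close>; it has no point to choose and covers nothing.\<close>
  define F where "F n = (\<lambda>B. SOME x. x \<in> B) ` (\<beta> n - {{}})" for n
  have some: "(SOME x. x \<in> B) \<in> B" if "B \<noteq> {}" for B :: "'a set"
    using that by (simp add: some_in_eq)
  have "F \<in> {F. \<forall>n\<in>level_times f \<psi> T. spanning_set f n \<epsilon> (level_set f \<psi> T n) (F n)}"
    unfolding mem_Collect_eq spanning_set_def
  proof (intro ballI)
    fix n y assume n: "n \<in> level_times f \<psi> T" and "y \<in> level_set f \<psi> T n"
    then obtain B where B: "B \<in> \<beta> n" "y \<in> B" "B \<in> cover_join f \<alpha> n"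
      using \<beta> unfolding cover_families_def by blast
    let ?x = "SOME x. x \<in> B"
    have "1 \<le> n" using n by (simp add: level_times_def)
    moreover have "?x \<in> B" using B(2) some by blast
    ultimately have "bowen_dist f n ?x y \<le> \<epsilon>"
      using dist_le_of_mem_cover_join[OF assms B(3) _ B(2)] by (simp add: bowen_dist_le_iff)
    moreover have "?x \<in> F n" using B(1,2) unfolding F_def by blast
    ultimately show "\<exists>x\<in>F n. bowen_dist f n x y \<le> \<epsilon>" by blast
  qed
  then have "Q_induced f \<psi> \<phi> T \<epsilon>
      \<le> (\<Sum>\<^sub>\<infinity>n\<in>level_times f \<psi> T. \<Sum>\<^sub>\<infinity>x\<in>F n. ennreal (exp (birkhoff_sum f \<phi> n x)))"
    unfolding Q_induced_def by (rule INF_lower)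
  also have "\<dots> \<le> (\<Sum>\<^sub>\<infinity>n\<in>level_times f \<psi> T. \<Sum>\<^sub>\<infinity>B\<in>\<beta> n.
      SUP x\<in>B. ennreal (exp (birkhoff_sum f \<phi> n x)))"
  proof (rule infsum_mono)
    fix n
    have "(\<Sum>\<^sub>\<infinity>x\<in>F n. ennreal (exp (birkhoff_sum f \<phi> n x)))
        \<le> (\<Sum>\<^sub>\<infinity>B\<in>\<beta> n - {{}}. SUP x\<in>B. ennreal (exp (birkhoff_sum f \<phi> n x)))"
      unfolding F_def by (intro infsum_image_le_ennreal SUP_upper some) auto
    also have "\<dots> \<le> (\<Sum>\<^sub>\<infinity>B\<in>\<beta> n. SUP x\<in>B. ennreal (exp (birkhoff_sum f \<phi> n x)))"
      by (rule infsum_mono_neutral) auto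
    finally show "(\<Sum>\<^sub>\<infinity>x\<in>F n. ennreal (exp (birkhoff_sum f \<phi> n x)))
        \<le> (\<Sum>\<^sub>\<infinity>B\<in>\<beta> n. SUP x\<in>B. ennreal (exp (birkhoff_sum f \<phi> n x)))" .
  qed auto
  finally show "Q_induced f \<psi> \<phi> T \<epsilon> \<le> (\<Sum>\<^sub>\<infinity>n\<in>level_times f \<psi> T. \<Sum>\<^sub>\<infinity>B\<in>\<beta> n.
      SUP x\<in>B. ennreal (exp (birkhoff_sum f \<phi> n x)))" .
qed

lemma level_times_mult_le:
  assumes "n \<in> level_times f \<psi> T" "\<And>x. m \<le> \<psi> x"
  shows "real n * m \<le> T"
proof -
  obtain x where x: "birkhoff_sum f \<psi> n x \<le> T"
    using assms(1) unfolding level_times_def by blast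
  have "real n * m = (\<Sum>i<n. m)" by simp
  also have "\<dots> \<le> birkhoff_sum f \<psi> n x"
    unfolding birkhoff_sum_def by (intro sum_mono assms(2))
  finally show ?thesis using x by simp
qed

text \<open>
  The oscillation of \<open>\<phi>\<close> at scale \<open>d\<close> is bounded by \<open>\<eta> * m\<close>. The factor \<open>m\<close> cancels against the
  bound \<open>T / m\<close> for the times at level \<open>T\<close>, which leaves the factor \<open>exp (\<eta> * T)\<close>.
\<close>

lemma p_induced_le_q_induced:
  fixes f :: "'a::metric_space \<Rightarrow> 'a"
  assumes "compact (UNIV :: 'a set)" "\<And>x. m \<le> \<psi> x" "0 \<le> \<eta>"
    and osc: "\<And>x y. dist x y \<le> d \<Longrightarrow> \<phi> x \<le> \<phi> y + \<eta> * m" and "cover_diam \<alpha> \<le> d"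
  shows "p_induced f \<psi> \<phi> T \<alpha> \<le> ennreal (exp (\<eta> * T)) * q_induced f \<psi> \<phi> T \<alpha>"
proof -
  let ?c = "ennreal (exp (\<eta> * T))" and ?e = "\<lambda>n x. ennreal (exp (birkhoff_sum f \<phi> n x))"
  have pointwise: "?e n x \<le> ?c * ?e n y"
    if n: "n \<in> level_times f \<psi> T" and "B \<in> cover_join f \<alpha> n" "x \<in> B" "y \<in> B" for n B x y
  proof -
    have "birkhoff_sum f \<phi> n x \<le> (\<Sum>i<n. \<phi> ((f ^^ i) y) + \<eta> * m)"
      unfolding birkhoff_sum_def
      using dist_le_of_mem_cover_join[OF assms(1,5) that(2-)] by (intro sum_mono osc) auto
    also have "\<dots> = birkhoff_sum f \<phi> n y + \<eta> * (real n * m)"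
      by (simp add: birkhoff_sum_def sum.distrib)
    also have "\<dots> \<le> birkhoff_sum f \<phi> n y + \<eta> * T"
      using level_times_mult_le[OF n assms(2)] \<open>0 \<le> \<eta>\<close> by (simp add: mult_left_mono)
    finally show ?thesis
      by (simp add: ennreal_mult[symmetric] exp_add[symmetric] add.commute ennreal_leI)
  qed
  have member: "(SUP x\<in>B. ?e n x) \<le> ?c * (INF x\<in>B. ?e n x)"
    if "n \<in> level_times f \<psi> T" "B \<in> cover_join f \<alpha> n" for n B
    \<comment> \<open>For \<open>B = {}\<close> this holds trivially: the supremum is \<open>0\<close> and the infimum is \<open>\<infinity>\<close>.\<close>
    unfolding le_exp_mult_iff
  proof (rule INF_greatest)
    fix y assume "y \<in> B"
    then have "(SUP x\<in>B. ?e n x) \<le> ?c * ?e n y"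
      using pointwise[OF that] by (intro SUP_least) auto
    then show "ennreal (exp (- (\<eta> * T))) * (SUP x\<in>B. ?e n x) \<le> ?e n y"
      by (simp only: le_exp_mult_iff)
  qed
  show ?thesis
    unfolding le_exp_mult_iff q_induced_def
  proof (rule INF_greatest)
    fix \<beta> assume \<beta>: "\<beta> \<in> cover_families f \<psi> T \<alpha>"
    have "p_induced f \<psi> \<phi> T \<alpha> \<le> (\<Sum>\<^sub>\<infinity>n\<in>level_times f \<psi> T. \<Sum>\<^sub>\<infinity>B\<in>\<beta> n. SUP x\<in>B. ?e n x)"
      unfolding p_induced_def by (rule INF_lower[OF \<beta>])
    also have "\<dots> \<le> (\<Sum>\<^sub>\<infinity>n\<in>level_times f \<psi> T. \<Sum>\<^sub>\<infinity>B\<in>\<beta> n. ?c * (INF x\<in>B. ?e n x))"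
      using \<beta> unfolding cover_families_def by (intro infsum_mono member) auto
    also have "\<dots> = ?c * (\<Sum>\<^sub>\<infinity>n\<in>level_times f \<psi> T. \<Sum>\<^sub>\<infinity>B\<in>\<beta> n. INF x\<in>B. ?e n x)"
      by (simp add: infsum_cmult_right_ennreal)
    finally show "ennreal (exp (- (\<eta> * T))) * p_induced f \<psi> \<phi> T \<alpha>
        \<le> (\<Sum>\<^sub>\<infinity>n\<in>level_times f \<psi> T. \<Sum>\<^sub>\<infinity>B\<in>\<beta> n. INF x\<in>B. ?e n x)"
      by (simp only: le_exp_mult_iff)
  qed
qed

lemma growth_rate_p_le_q:
  fixes f :: "'a::metric_space \<Rightarrow> 'a"
  assumes "compact (UNIV :: 'a set)" "continuous_on UNIV \<phi>"
    and "0 < m" "\<And>x. m \<le> \<psi> x" "0 < \<eta>"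
  shows "\<exists>d>0. \<forall>\<alpha>. cover_diam \<alpha> \<le> d \<longrightarrow>
      growth_rate (\<lambda>T. p_induced f \<psi> \<phi> T \<alpha>) \<le> growth_rate (\<lambda>T. q_induced f \<psi> \<phi> T \<alpha>) + ereal \<eta>"
proof -
  have "uniformly_continuous_on UNIV \<phi>"
    using assms(1,2) by (rule compact_uniformly_continuous[rotated])
  moreover have "0 < \<eta> * m" using assms by simp
  ultimately obtain e where e: "0 < e" "\<And>x y. dist x y < e \<Longrightarrow> dist (\<phi> x) (\<phi> y) < \<eta> * m"
    unfolding uniformly_continuous_on_def by (metis UNIV_I dist_commute)
  have osc: "\<phi> x \<le> \<phi> y + \<eta> * m" if "dist x y \<le> e / 2" for x y
    using e(1) e(2)[of x y] that by (simp add: dist_real_def)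
  show ?thesis
  proof (intro exI[of _ "e / 2"] conjI allI impI)
    show "growth_rate (\<lambda>T. p_induced f \<psi> \<phi> T \<alpha>)
        \<le> growth_rate (\<lambda>T. q_induced f \<psi> \<phi> T \<alpha>) + ereal \<eta>" if "cover_diam \<alpha> \<le> e / 2" for \<alpha>
      using assms osc that by (intro growth_rate_exp_le p_induced_le_q_induced) auto
  qed (use e in simp)
qed

section \<open>Limits along covers of vanishing diameter\<close>

text \<open>
  The two estimates say that \<open>h \<alpha>\<close> is close to \<open>P\<close>, uniformly over all open covers of small
  diameter. The upper one is not strict, so that it passes to the supremum.
\<close>

lemma tendsto_of_uniform_cover_bounds:
  fixes h :: "'a::metric_space set set \<Rightarrow> ereal" and P :: ereal
  assumes lower: "\<And>r::real. ereal r < P \<Longrightarrow>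
      \<exists>d>0. \<forall>\<alpha>. open_cover \<alpha> \<and> cover_diam \<alpha> \<le> d \<longrightarrow> ereal r \<le> h \<alpha>"
    and upper: "\<And>r::real. P < ereal r \<Longrightarrow>
      \<exists>d>0. \<forall>\<alpha>. open_cover \<alpha> \<and> cover_diam \<alpha> \<le> d \<longrightarrow> h \<alpha> \<le> ereal r"
  shows "((\<lambda>\<delta>::real. SUP \<alpha>\<in>{\<alpha>. open_cover \<alpha> \<and> cover_diam \<alpha> \<le> \<delta>}. h \<alpha>) \<longlongrightarrow> P) (at_right 0)"
    and "\<And>\<alpha>. (\<forall>k::nat. open_cover (\<alpha> k)) \<Longrightarrow> (\<lambda>k. cover_diam (\<alpha> k)) \<longlonglongrightarrow> 0 \<Longrightarrow>
      (\<lambda>k. h (\<alpha> k)) \<longlonglongrightarrow> P"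
proof -
  let ?C = "\<lambda>\<delta>::real. {\<alpha>::'a set set. open_cover \<alpha> \<and> cover_diam \<alpha> \<le> \<delta>}"
  have small: "\<forall>\<^sub>F \<delta> in at_right 0. 0 < \<delta> \<and> \<delta> \<le> d" if "0 < d" for d :: real
    unfolding eventually_at_right_field using that by (intro exI[of _ d]) auto
  show "((\<lambda>\<delta>. SUP \<alpha>\<in>?C \<delta>. h \<alpha>) \<longlongrightarrow> P) (at_right 0)"
  proof (rule order_tendstoI)
    fix a assume "a < P"
    then obtain r where r: "a < ereal r" "ereal r < P" using ereal_dense2 by blast
    obtain d where d: "0 < d" "\<And>\<alpha>. \<alpha> \<in> ?C d \<Longrightarrow> ereal r \<le> h \<alpha>" using lower[OF r(2)] by auto
    show "\<forall>\<^sub>F \<delta> in at_right 0. a < (SUP \<alpha>\<in>?C \<delta>. h \<alpha>)"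
      using small[OF d(1)]
    proof eventually_elim
      fix \<delta> :: real assume \<delta>: "0 < \<delta> \<and> \<delta> \<le> d"
      obtain \<alpha> where \<alpha>: "\<alpha> \<in> ?C \<delta>" using ex_open_cover_diam_le[of \<delta>] \<delta> by auto
      then have "ereal r \<le> h \<alpha>" using d(2)[of \<alpha>] \<delta> by auto
      then have "a < h \<alpha>" using r(1) by order
      also have "h \<alpha> \<le> (SUP \<alpha>\<in>?C \<delta>. h \<alpha>)" using \<alpha> by (rule SUP_upper)
      finally show "a < (SUP \<alpha>\<in>?C \<delta>. h \<alpha>)" .
    qed
  next
    fix b assume "P < b"
    then obtain r where r: "P < ereal r" "ereal r < b" using ereal_dense2 by blast
    obtain d where d: "0 < d" "\<And>\<alpha>. \<alpha> \<in> ?C d \<Longrightarrow> h \<alpha> \<le> ereal r" using upper[OF r(1)] by auto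
    show "\<forall>\<^sub>F \<delta> in at_right 0. (SUP \<alpha>\<in>?C \<delta>. h \<alpha>) < b"
      using small[OF d(1)]
    proof eventually_elim
      fix \<delta> :: real assume \<delta>: "0 < \<delta> \<and> \<delta> \<le> d"
      have "(SUP \<alpha>\<in>?C \<delta>. h \<alpha>) \<le> ereal r" using \<delta> by (intro SUP_least d(2)) auto
      then show "(SUP \<alpha>\<in>?C \<delta>. h \<alpha>) < b" using r(2) by order
    qed
  qed
  fix \<alpha> :: "nat \<Rightarrow> 'a set set"
  assume cover: "\<forall>k. open_cover (\<alpha> k)" and lim: "(\<lambda>k. cover_diam (\<alpha> k)) \<longlonglongrightarrow> 0"
  have ev: "\<forall>\<^sub>F k in sequentially. \<alpha> k \<in> ?C d" if "0 < d" for d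
    using order_tendstoD(2)[OF lim that] by eventually_elim (use cover in auto)
  show "(\<lambda>k. h (\<alpha> k)) \<longlonglongrightarrow> P"
  proof (rule order_tendstoI)
    fix a assume "a < P"
    then obtain r where r: "a < ereal r" "ereal r < P" using ereal_dense2 by blast
    obtain d where d: "0 < d" "\<And>\<alpha>. \<alpha> \<in> ?C d \<Longrightarrow> ereal r \<le> h \<alpha>" using lower[OF r(2)] by auto
    show "\<forall>\<^sub>F k in sequentially. a < h (\<alpha> k)"
      using ev[OF d(1)] by eventually_elim (use d(2) r(1) in \<open>blast intro: less_le_trans\<close>)
  next
    fix b assume "P < b"
    then obtain r where r: "P < ereal r" "ereal r < b" using ereal_dense2 by blast
    obtain d where d: "0 < d" "\<And>\<alpha>. \<alpha> \<in> ?C d \<Longrightarrow> h \<alpha> \<le> ereal r" using upper[OF r(1)] by auto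
    show "\<forall>\<^sub>F k in sequentially. h (\<alpha> k) < b"
      using ev[OF d(1)] by eventually_elim (use d(2) r(2) in \<open>blast intro: le_less_trans\<close>)
  qed
qed

section \<open>The induced pressure through open covers\<close>

lemma growth_rate_Q_le_induced_pressure:
  assumes "0 < \<epsilon>"
  shows "growth_rate (\<lambda>T. Q_induced f \<psi> \<phi> T \<epsilon>) \<le> induced_pressure f \<psi> \<phi>"
proof (rule tendsto_lowerbound[OF induced_pressure_tendsto])
  show "\<forall>\<^sub>F e in at_right 0. growth_rate (\<lambda>T. Q_induced f \<psi> \<phi> T \<epsilon>)
      \<le> growth_rate (\<lambda>T. Q_induced f \<psi> \<phi> T e)"
    using assms unfolding eventually_at_right_field
    by (intro exI[of _ \<epsilon>]) (auto intro!: growth_rate_mono Q_induced_antimono)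
qed simp

theorem theorem2p1:
  fixes f :: "'a::metric_space \<Rightarrow> 'a"
    and \<phi> \<psi> :: "'a \<Rightarrow> real"
    and m M :: real
  assumes "compact (UNIV :: 'a set)"
    and "continuous_on UNIV f"
    and "continuous_on UNIV \<phi>"
    and "continuous_on UNIV \<psi>"
    and "0 < m"
    and "\<And>x. m \<le> \<psi> x"
    and "\<And>x. \<psi> x \<le> M"
  shows
    "((\<lambda>\<delta>::real. SUP \<alpha>\<in>{\<alpha>. open_cover \<alpha> \<and> cover_diam \<alpha> \<le> \<delta>}.
          growth_rate (\<lambda>T. p_induced f \<psi> \<phi> T \<alpha>))
        \<longlongrightarrow> induced_pressure f \<psi> \<phi>) (at_right 0)
     \<and> (\<forall>\<alpha> :: nat \<Rightarrow> 'a set set.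
          (\<forall>k. open_cover (\<alpha> k)) \<and> (\<lambda>k. cover_diam (\<alpha> k)) \<longlonglongrightarrow> 0 \<longrightarrow>
          (\<lambda>k. growth_rate (\<lambda>T. p_induced f \<psi> \<phi> T (\<alpha> k))) \<longlonglongrightarrow> induced_pressure f \<psi> \<phi>)
     \<and> ((\<lambda>\<delta>::real. SUP \<alpha>\<in>{\<alpha>. open_cover \<alpha> \<and> cover_diam \<alpha> \<le> \<delta>}.
          growth_rate (\<lambda>T. q_induced f \<psi> \<phi> T \<alpha>))
        \<longlongrightarrow> induced_pressure f \<psi> \<phi>) (at_right 0)
     \<and> (\<forall>\<alpha> :: nat \<Rightarrow> 'a set set.
          (\<forall>k. open_cover (\<alpha> k)) \<and> (\<lambda>k. cover_diam (\<alpha> k)) \<longlonglongrightarrow> 0 \<longrightarrow>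
          (\<lambda>k. growth_rate (\<lambda>T. q_induced f \<psi> \<phi> T (\<alpha> k))) \<longlonglongrightarrow> induced_pressure f \<psi> \<phi>)
     \<and> (SUP \<alpha>\<in>{\<alpha>. open_cover \<alpha>}. growth_rate (\<lambda>T. q_induced f \<psi> \<phi> T \<alpha>))
        = induced_pressure f \<psi> \<phi>"
proof -
  let ?P = "induced_pressure f \<psi> \<phi>"
  let ?Q = "\<lambda>\<epsilon>. growth_rate (\<lambda>T. Q_induced f \<psi> \<phi> T \<epsilon>)"
  let ?p = "\<lambda>\<alpha>. growth_rate (\<lambda>T. p_induced f \<psi> \<phi> T \<alpha>)"
  let ?q = "\<lambda>\<alpha>. growth_rate (\<lambda>T. q_induced f \<psi> \<phi> T \<alpha>)"
  have q_le: "?q \<alpha> \<le> ?P" if "open_cover \<alpha>" for \<alpha>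
  proof -
    obtain \<epsilon> where \<epsilon>: "0 < \<epsilon>" "\<And>x. \<exists>A\<in>\<alpha>. cball x \<epsilon> \<subseteq> A"
      using ex_Lebesgue_radius[OF assms(1) \<open>open_cover \<alpha>\<close>] by blast
    have "?q \<alpha> \<le> ?Q \<epsilon>"
      using \<epsilon> by (intro growth_rate_mono q_induced_le_Q_induced)
    also have "\<dots> \<le> ?P"
      using \<epsilon>(1) by (rule growth_rate_Q_le_induced_pressure)
    finally show ?thesis .
  qed
  have p_le_q: "\<exists>d>0. \<forall>\<alpha>. cover_diam \<alpha> \<le> d \<longrightarrow> ?p \<alpha> \<le> ?q \<alpha> + ereal \<eta>" if "0 < \<eta>" for \<eta>
    by (rule growth_rate_p_le_q[OF assms(1,3,5) _ that]) (rule assms(6))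
  have p_ge: "\<exists>d>0. \<forall>\<alpha>. cover_diam \<alpha> \<le> d \<longrightarrow> ereal r \<le> ?p \<alpha>" if "ereal r < ?P" for r
  proof -
    have "\<forall>\<^sub>F \<epsilon> in at_right 0. ereal r < ?Q \<epsilon> \<and> 0 < \<epsilon>"
      using order_tendstoD(1)[OF induced_pressure_tendsto that] eventually_at_right_less
      by (rule eventually_conj)
    then obtain d where d: "ereal r < ?Q d" "0 < d"
      using eventually_happens'[OF trivial_limit_at_right_real] by blast
    have "ereal r \<le> ?p \<alpha>" if "cover_diam \<alpha> \<le> d" for \<alpha>
    proof -
      have "?Q d \<le> ?p \<alpha>"
        by (intro growth_rate_mono Q_induced_le_p_induced assms(1) that)
      then show ?thesis using d(1) by order
    qed
    then show ?thesis using d(2) by blast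
  qed
  have p_le: "\<exists>d>0. \<forall>\<alpha>. open_cover \<alpha> \<and> cover_diam \<alpha> \<le> d \<longrightarrow> ?p \<alpha> \<le> ereal r"
    if r: "?P < ereal r" for r
  proof -
    obtain s where s: "?P < ereal s" "ereal s < ereal r" using ereal_dense2[OF r] by blast
    obtain d where d: "0 < d"
        "\<And>\<alpha>. cover_diam \<alpha> \<le> d \<Longrightarrow> ?p \<alpha> \<le> ?q \<alpha> + ereal (r - s)"
      using p_le_q[of "r - s"] s(2) by auto
    have "?p \<alpha> \<le> ereal r" if "open_cover \<alpha>" "cover_diam \<alpha> \<le> d" for \<alpha>
    proof -
      have "?q \<alpha> \<le> ereal s" using q_le[OF that(1)] s(1) by order
      then have "?q \<alpha> + ereal (r - s) \<le> ereal s + ereal (r - s)" by (rule add_right_mono)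
      then show ?thesis using d(2)[OF that(2)] by simp
    qed
    then show ?thesis using d(1) by blast
  qed
  have q_ge: "\<exists>d>0. \<forall>\<alpha>. cover_diam \<alpha> \<le> d \<longrightarrow> ereal r \<le> ?q \<alpha>" if r: "ereal r < ?P" for r
  proof -
    obtain s where s: "ereal r < ereal s" "ereal s < ?P" using ereal_dense2[OF r] by blast
    obtain d where d: "0 < d" "\<And>\<alpha>. cover_diam \<alpha> \<le> d \<Longrightarrow> ereal s \<le> ?p \<alpha>"
      using p_ge[OF s(2)] by blast
    obtain d' where d': "0 < d'"
        "\<And>\<alpha>. cover_diam \<alpha> \<le> d' \<Longrightarrow> ?p \<alpha> \<le> ?q \<alpha> + ereal (s - r)"
      using p_le_q[of "s - r"] s(1) by auto
    have "ereal r \<le> ?q \<alpha>" if "cover_diam \<alpha> \<le> min d d'" for \<alpha>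
    proof -
      have "ereal s \<le> ?q \<alpha> + ereal (s - r)"
        using d(2)[of \<alpha>] d'(2)[of \<alpha>] that by (auto intro: order_trans)
      \<comment> \<open>The value of \<open>?q \<alpha>\<close> may be infinite, so \<open>s - r\<close> is not simply cancelled.\<close>
      then show ?thesis by (cases "?q \<alpha>") auto
    qed
    then show ?thesis using d(1) d'(1) by (intro exI[of _ "min d d'"]) auto
  qed
  have p_bounds: "\<exists>d>0. \<forall>\<alpha>. open_cover \<alpha> \<and> cover_diam \<alpha> \<le> d \<longrightarrow> ereal r \<le> ?p \<alpha>"
    if "ereal r < ?P" for r
    using p_ge[OF that] by blast
  have q_bounds: "\<exists>d>0. \<forall>\<alpha>. open_cover \<alpha> \<and> cover_diam \<alpha> \<le> d \<longrightarrow> ereal r \<le> ?q \<alpha>"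
    if "ereal r < ?P" for r
    using q_ge[OF that] by blast
  have q_upper: "\<exists>d>0. \<forall>\<alpha>. open_cover \<alpha> \<and> cover_diam \<alpha> \<le> d \<longrightarrow> ?q \<alpha> \<le> ereal r"
    if "?P < ereal r" for r
    using that by (intro exI[of _ 1]) (auto intro: order_trans[OF q_le])
  note p_limits = tendsto_of_uniform_cover_bounds[OF p_bounds p_le]
  note q_limits = tendsto_of_uniform_cover_bounds[OF q_bounds q_upper]
  have "(SUP \<alpha>\<in>{\<alpha>. open_cover \<alpha>}. ?q \<alpha>) = ?P"
  proof (rule antisym)
    show "(SUP \<alpha>\<in>{\<alpha>. open_cover \<alpha>}. ?q \<alpha>) \<le> ?P"
      using q_le by (intro SUP_least) auto
    show "?P \<le> (SUP \<alpha>\<in>{\<alpha>. open_cover \<alpha>}. ?q \<alpha>)"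
    proof (rule tendsto_upperbound[OF q_limits(1)])
      show "\<forall>\<^sub>F \<delta> in at_right 0. (SUP \<alpha>\<in>{\<alpha>. open_cover \<alpha> \<and> cover_diam \<alpha> \<le> \<delta>}. ?q \<alpha>)
          \<le> (SUP \<alpha>\<in>{\<alpha>. open_cover \<alpha>}. ?q \<alpha>)"
        by (intro always_eventually allI SUP_subset_mono) auto
    qed auto
  qed
  then show ?thesis using p_limits q_limits by blast
qed

end
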